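(* Let $R$ be a commutative ring and $X$ an indeterminate over $R$. Then the following conditions are equivalent. (1) $R[X]$ (or equivalently $R$) is a UFD. (2) $R[X]$ is a unique factorization ring. (3) $R[X]$ is atomic and any two factorizations of nonzero nonunits into irreducibles are homomorphic.
   Context: All rings are commutative with identity $1\neq 0$. Let $A$ be a ring and $a,b\in A$. Write $a\sim b$ (associates) if $Aa=Ab$; $a\approx b$ (strong associates) if $a=ub$ for a unit $u$; $a\cong b$ (very strong associates) if $a\sim b$ and either $a=b=0$, or $a\ne 0$ and $a=rb$ with $r\in A$ implies $r$ is a unit. A nonunit $a\in A$ is irreducible (resp., strongly irreducible, very strongly irreducible) if $a=bc$ with $b,c\in A$ implies $a\sim b$ or $a\sim c$ (resp., $a\approx b$ or $a\approx c$; $a\cong b$ or $a\cong c$); it is $m$-irreducible if $Aa$ is maximal among proper principal ideals. $A$ is atomic (resp., strongly atomic, $m$-atomic, very strongly atomic) if every nonzero nonunit is a finite product of irreducible (resp., strongly irreducible, $m$-irreducible, very strongly irreducible) elements. Two factorizations $a=a_1\cdots a_n=b_1\cdots b_m$ of a nonunit into nonunits are isomorphic (resp., strongly isomorphic, very strongly isomorphic) if $n=m$ and there is $\sigma\in S_n$ with $a_i\sim b_{\sigma(i)}$ (resp., $a_i\approx b_{\sigma(i)}$, $a_i\cong b_{\sigma(i)}$) for all $i$. They are homomorphic if for each $i\in\{1,\dots,n\}$ there is $j\in\{1,\dots,m\}$ with $a_i\sim b_j$ and for each $i\in\{1,\dots,m\}$ there is $j\in\{1,\dots,n\}$ with $b_i\sim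 a_j$. For $\alpha\in\{$atomic, strongly atomic, $m$-atomic, very strongly atomic$\}$ and $\beta\in\{$isomorphic, strongly isomorphic, very strongly isomorphic$\}$, $A$ is an $(\alpha,\beta)$-unique factorization ring if $A$ is $\alpha$ and any two factorizations of a nonzero nonunit into irreducible elements of the type used to define $\alpha$ are $\beta$. $A$ is a unique factorization ring (UFR) if it is an $(\alpha,\beta)$-unique factorization ring for some (and hence, as is known, all) $(\alpha,\beta)$. *)

theory Defs
  imports
    "HOL-Computational_Algebra.Polynomial"
    "HOL-Combinatorics.Permutations"
    "HOL-Algebra.Ring_Divisibility"
    "HOL-Algebra.Algebraic_Closure_Type"
begin

text \<open>Rings are types of class \<open>comm_ring_1\<close>: commutative, with 1 and 0 distinct from 1.
  Zero divisors are allowed, so \<open>Factorial_Ring.irreducible\<close>, which asks one of the factors to be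
  a unit, is not the notion of irreducibility used here.\<close>

definition principal_ideal_of :: "'a::comm_ring_1 \<Rightarrow> 'a set" where
  "principal_ideal_of a = {r * a | r. True}"

definition associates :: "'a::comm_ring_1 \<Rightarrow> 'a \<Rightarrow> bool" where
  "associates a b \<longleftrightarrow> principal_ideal_of a = principal_ideal_of b"

definition strong_associates :: "'a::comm_ring_1 \<Rightarrow> 'a \<Rightarrow> bool" where
  "strong_associates a b \<longleftrightarrow> (\<exists>u. u dvd 1 \<and> a = u * b)"

definition very_strong_associates :: "'a::comm_ring_1 \<Rightarrow> 'a \<Rightarrow> bool" where
  "very_strong_associates a b \<longleftrightarrow>
     associates a b \<and> (a = 0 \<and> b = 0 \<or> a \<noteq> 0 \<and> (\<forall>r. a = r * b \<longrightarrow> r dvd 1))"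


definition irreducible_elem :: "'a::comm_ring_1 \<Rightarrow> bool" where
  "irreducible_elem a \<longleftrightarrow>
     \<not> a dvd 1 \<and> (\<forall>b c. a = b * c \<longrightarrow> associates a b \<or> associates a c)"

definition strongly_irreducible_elem :: "'a::comm_ring_1 \<Rightarrow> bool" where
  "strongly_irreducible_elem a \<longleftrightarrow>
     \<not> a dvd 1 \<and> (\<forall>b c. a = b * c \<longrightarrow> strong_associates a b \<or> strong_associates a c)"

definition very_strongly_irreducible_elem :: "'a::comm_ring_1 \<Rightarrow> bool" where
  "very_strongly_irreducible_elem a \<longleftrightarrow>
     \<not> a dvd 1 \<and> (\<forall>b c. a = b * c \<longrightarrow> very_strong_associates a b \<or> very_strong_associates a c)"

definition m_irreducible_elem :: "'a::comm_ring_1 \<Rightarrow> bool" where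
  "m_irreducible_elem a \<longleftrightarrow>
     \<not> a dvd 1 \<and>
     (\<forall>b. principal_ideal_of b \<noteq> UNIV \<and> principal_ideal_of a \<subseteq> principal_ideal_of b \<longrightarrow>
          principal_ideal_of b = principal_ideal_of a)"


text \<open>Here \<open>irr\<close> ranges over the kinds of irreducibility above. A factorization is a list of
  factors; a list whose product is a nonunit is automatically nonempty.\<close>

definition factorization_into :: "('a::comm_ring_1 \<Rightarrow> bool) \<Rightarrow> 'a \<Rightarrow> 'a list \<Rightarrow> bool" where
  "factorization_into irr a xs \<longleftrightarrow> (\<forall>x\<in>set xs. irr x) \<and> prod_list xs = a"

definition atomic_wrt :: "('a::comm_ring_1 \<Rightarrow> bool) \<Rightarrow> bool" where
  "atomic_wrt irr \<longleftrightarrow> (\<forall>a. a \<noteq> 0 \<and> \<not> a dvd 1 \<longrightarrow> (\<exists>xs. factorization_into irr a xs))"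

definition factorizations_agree ::
    "('a::comm_ring_1 \<Rightarrow> bool) \<Rightarrow> ('a list \<Rightarrow> 'a list \<Rightarrow> bool) \<Rightarrow> bool" where
  "factorizations_agree irr eqv \<longleftrightarrow>
     (\<forall>a xs ys. a \<noteq> 0 \<and> \<not> a dvd 1 \<and> factorization_into irr a xs \<and> factorization_into irr a ys \<longrightarrow>
        eqv xs ys)"

definition isomorphic_wrt :: "('a \<Rightarrow> 'a \<Rightarrow> bool) \<Rightarrow> 'a list \<Rightarrow> 'a list \<Rightarrow> bool" where
  "isomorphic_wrt rel xs ys \<longleftrightarrow>
     length xs = length ys \<and>
     (\<exists>\<sigma>. \<sigma> permutes {..<length xs} \<and> (\<forall>i<length xs. rel (xs ! i) (ys ! \<sigma> i)))"

definition homomorphic :: "'a::comm_ring_1 list \<Rightarrow> 'a list \<Rightarrow> bool" where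
  "homomorphic xs ys \<longleftrightarrow>
     (\<forall>x\<in>set xs. \<exists>y\<in>set ys. associates x y) \<and> (\<forall>y\<in>set ys. \<exists>x\<in>set xs. associates y x)"


text \<open>The ring \<open>'a\<close> is a unique factorization ring if it is an \<open>(\<alpha>, \<beta>)\<close>-unique factorization
  ring for some pair: \<open>\<alpha>\<close> is determined by the kind of irreducible elements, and \<open>\<beta>\<close> by the kind
  of associates used to compare factors.\<close>

definition unique_factorization_ring :: "'a::comm_ring_1 itself \<Rightarrow> bool" where
  "unique_factorization_ring (_ :: 'a itself) \<longleftrightarrow>
     (\<exists>irr \<in> {irreducible_elem, strongly_irreducible_elem, m_irreducible_elem,
                very_strongly_irreducible_elem :: 'a \<Rightarrow> bool}.
      \<exists>rel \<in> {associates, strong_associates, very_strong_associates}.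
        atomic_wrt irr \<and> factorizations_agree irr (isomorphic_wrt rel))"

text \<open>\<open>ring_of_type_algebra\<close> is the type \<open>'a\<close> with its class operations, as a ring record with
  carrier \<open>UNIV\<close>; \<open>factorial_domain\<close> is the library's notion of a UFD.\<close>

definition unique_factorization_domain :: "'a::comm_ring_1 itself \<Rightarrow> bool" where
  "unique_factorization_domain (_ :: 'a itself) \<longleftrightarrow>
     factorial_domain (ring_of_type_algebra :: 'a ring)"

end

theory Submission
  imports Defs
begin

text \<open>The heart of the matter is that a polynomial ring \<open>R[X]\<close> that is atomic, for any of the four
  kinds of irreducible elements, and whose factorizations into such elements are pairwise
  homomorphic, is an integral domain (\<open>coefficients_zero_divisor_free\<close>).

  Suppose \<open>a * b = 0\<close> in \<open>R\<close> with \<open>a \<noteq> 0\<close>. Then \<open>a = a * (1 + b * X * h)\<close> for every \<open>h\<close>, so all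
  irreducible factors of \<open>1 + b * X * h\<close> are associates of factors of \<open>a\<close> in one fixed
  factorization. As in Euclid's proof that there are infinitely many primes, finitely many factors
  cannot serve all these polynomials, unless they are units, and this forces \<open>b\<close> to be nilpotent
  (\<open>zero_divisor_nilpotent\<close>). In particular \<open>R\<close> has no idempotents besides \<open>0\<close> and \<open>1\<close>, so each
  \<open>X + c\<close> has only trivial factorizations (\<open>monic_linear_trivial_factors\<close>). For \<open>n\<^sup>2 = 0\<close> the two
  factorizations \<open>X * X = (X + n) * (X - n)\<close> then yield \<open>n = 0\<close>. So \<open>R\<close> is reduced, and its zero
  divisors, being nilpotent, are zero.

  In an atomic domain with homomorphic factorizations irreducible elements are prime, so the domain
  is a UFD (\<open>homomorphic_factorizations_imp_UFD\<close>). Conversely, the factorizations of nonzero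
  nonunits in a UFD are isomorphic (\<open>UFD_imp_irreducible_factorization\<close>), and isomorphic
  factorizations are homomorphic.

  That \<open>R[X]\<close> is a UFD if and only if \<open>R\<close> is one is Gauss's theorem
  (\<open>unique_factorization_domain_poly_iff\<close>). It is proved for commutative ring types on which
  the absence of zero divisors is an assumption and not a type class, and without fraction
  fields.\<close>

section \<open>Divisibility in a commutative ring\<close>

lemma principal_ideal_subset_iff:
  "principal_ideal_of a \<subseteq> principal_ideal_of b \<longleftrightarrow> b dvd a"
proof
  assume "principal_ideal_of a \<subseteq> principal_ideal_of b"
  moreover have "a \<in> principal_ideal_of a"
    unfolding principal_ideal_of_def by (metis (mono_tags, lifting) mem_Collect_eq mult_1)
  ultimately have "a \<in> principal_ideal_of b"
    by blast
  then show "b dvd a"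
    unfolding principal_ideal_of_def by auto
next
  assume "b dvd a"
  then obtain k where "a = b * k" ..
  then have "r * a = (r * k) * b" for r
    by (simp add: ac_simps)
  then show "principal_ideal_of a \<subseteq> principal_ideal_of b"
    unfolding principal_ideal_of_def by blast
qed

lemma associates_iff_dvd: "associates a b \<longleftrightarrow> a dvd b \<and> b dvd a"
  unfolding associates_def set_eq_subset principal_ideal_subset_iff by auto

lemma principal_ideal_eq_UNIV_iff: "principal_ideal_of b = UNIV \<longleftrightarrow> b dvd 1"
proof -
  have "principal_ideal_of b = UNIV \<longleftrightarrow> principal_ideal_of (1::'a) \<subseteq> principal_ideal_of b"
    by (auto simp: principal_ideal_of_def)
  then show ?thesis
    by (simp add: principal_ideal_subset_iff)
qed

lemma m_irreducible_elem_iff: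
  "m_irreducible_elem a \<longleftrightarrow> \<not> a dvd 1 \<and> (\<forall>b. b dvd a \<and> \<not> b dvd 1 \<longrightarrow> a dvd b)"
proof -
  have "principal_ideal_of b = principal_ideal_of a \<longleftrightarrow> b dvd a \<and> a dvd b" for b
    using principal_ideal_subset_iff[of a b] principal_ideal_subset_iff[of b a] by auto
  then show ?thesis
    unfolding m_irreducible_elem_def principal_ideal_eq_UNIV_iff principal_ideal_subset_iff
    by auto
qed

lemma mult_unit_dvd_iff_comm_ring:
  fixes a u :: "'a::comm_ring_1"
  assumes "u dvd 1"
  shows "a * u dvd b \<longleftrightarrow> a dvd b"
proof
  show "a * u dvd b \<Longrightarrow> a dvd b"
    by (rule dvd_mult_left)
  assume "a dvd b"
  moreover obtain v where "1 = u * v"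
    using assms ..
  then have "a * u * v = a"
    by (simp add: mult.assoc)
  then have "a * u dvd a"
    by (metis dvd_triv_left)
  ultimately show "a * u dvd b"
    by (rule dvd_trans[rotated])
qed

lemma unit_mult_dvd_iff_comm_ring:
  fixes a u :: "'a::comm_ring_1"
  shows "u dvd 1 \<Longrightarrow> u * a dvd b \<longleftrightarrow> a dvd b"
  by (metis mult.commute mult_unit_dvd_iff_comm_ring)

lemma dvd_mult_unit_iff_comm_ring:
  fixes a u :: "'a::comm_ring_1"
  assumes "u dvd 1"
  shows "a dvd b * u \<longleftrightarrow> a dvd b"
  using mult_unit_dvd_iff_comm_ring[OF assms, of b b] by (meson dvd_mult2 dvd_refl dvd_trans)

lemma strong_associates_imp_associates:
  assumes "strong_associates a b"
  shows "associates a b"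
proof -
  obtain u where u: "u dvd 1" "a = u * b"
    using assms unfolding strong_associates_def by blast
  then show ?thesis
    by (auto simp: associates_iff_dvd unit_mult_dvd_iff_comm_ring)
qed

lemma very_strong_associates_imp_associates:
  "very_strong_associates a b \<Longrightarrow> associates a b"
  by (simp add: very_strong_associates_def)

lemma dvd_prod_list:
  fixes x :: "'a::comm_monoid_mult"
  shows "x \<in> set xs \<Longrightarrow> x dvd prod_list xs"
  by (induction xs) auto

lemma prime_elem_dvd_prod_list:
  assumes "prime_elem p" "p dvd prod_list xs"
  shows "\<exists>x\<in>set xs. p dvd x"
  using assms(2)
proof (induction xs)
  case Nil
  with assms(1) show ?case by (simp add: prime_elem_def)
next
  case (Cons x xs)
  with assms(1) show ?case by (auto simp: prime_elem_dvd_mult_iff)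
qed


section \<open>The four kinds of irreducible elements\<close>

text \<open>The kinds of irreducible elements that may be used to define a unique factorization ring.
  The weakest of them is \<open>irreducible_elem\<close>.\<close>

definition irreducibility_kinds :: "('a::comm_ring_1 \<Rightarrow> bool) set" where
  "irreducibility_kinds = {irreducible_elem, strongly_irreducible_elem, m_irreducible_elem,
     very_strongly_irreducible_elem}"

lemma irreducible_elem_kind: "irreducible_elem \<in> irreducibility_kinds"
  by (simp add: irreducibility_kinds_def)

lemma irreducible_elem_if_kind:
  assumes irr: "irr \<in> irreducibility_kinds" and a: "irr a"
  shows "irreducible_elem a"
proof -
  have "irreducible_elem a" if m: "m_irreducible_elem a"
    unfolding irreducible_elem_def
  proof (intro conjI allI impI)
    show "\<not> a dvd 1"
      using m by (simp add: m_irreducible_elem_iff)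
    fix b c assume a: "a = b * c"
    show "associates a b \<or> associates a c"
    proof (cases "b dvd 1")
      case True
      then show ?thesis using a by (auto simp: associates_iff_dvd unit_mult_dvd_iff_comm_ring)
    next
      case False
      then show ?thesis using a m by (auto simp: associates_iff_dvd m_irreducible_elem_iff)
    qed
  qed
  moreover have "irreducible_elem a" if "strongly_irreducible_elem a"
    using that unfolding strongly_irreducible_elem_def irreducible_elem_def
    by (metis strong_associates_imp_associates)
  moreover have "irreducible_elem a" if "very_strongly_irreducible_elem a"
    using that unfolding very_strongly_irreducible_elem_def irreducible_elem_def
    by (metis very_strong_associates_imp_associates)
  ultimately show ?thesis
    using irr a unfolding irreducibility_kinds_def by fast
qed

text \<open>A regular element with only trivial factorizations is irreducible in every sense. Regularity
  is what makes the cofactor in the very strong sense unique: \<open>r * b = c * b\<close> forces \<open>r = c\<close>.\<close>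

lemma kind_if_trivial_factors:
  assumes irr: "irr \<in> irreducibility_kinds"
    and nonunit: "\<not> a dvd 1"
    and factors: "\<And>b c. a = b * c \<Longrightarrow> b dvd 1 \<or> c dvd 1"
    and regular: "\<And>r. a * r = 0 \<Longrightarrow> r = 0"
  shows "irr a"
proof -
  have "a \<noteq> 0"
    using regular[of 1] by auto
  have vs: "very_strong_associates a b" if a: "a = b * c" and c: "c dvd 1" for b c
    unfolding very_strong_associates_def
  proof (intro conjI disjI2 allI impI)
    show "associates a b"
      using a c by (auto simp: associates_iff_dvd mult_unit_dvd_iff_comm_ring)
    fix r assume r: "a = r * b"
    have "b * (c - r) = 0"
      using a r by (simp add: algebra_simps)
    then have "a * (c - r) = 0"
      unfolding a by (metis mult.assoc mult.commute mult_zero_left)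
    then show "r dvd 1"
      using regular c by force
  qed fact
  have strong: "strong_associates a b" if "a = b * c" "c dvd 1" for b c
    using that by (auto simp: strong_associates_def mult.commute)
  have m: "m_irreducible_elem a"
    unfolding m_irreducible_elem_iff
  proof (intro conjI allI impI nonunit)
    fix b assume b: "b dvd a \<and> \<not> b dvd 1"
    then obtain c where "a = b * c" by (auto elim: dvdE)
    with b factors show "a dvd b" by (metis dvd_refl mult_unit_dvd_iff_comm_ring)
  qed
  have either: "P a b \<or> P a c"
    if a: "a = b * c" and P: "\<And>b c. a = b * c \<Longrightarrow> c dvd 1 \<Longrightarrow> P a b" for P b c
    using factors[OF a] P[of b c] P[of c b] a by (auto simp: mult.commute)
  have "very_strongly_irreducible_elem a"
    unfolding very_strongly_irreducible_elem_def
    using nonunit either[where P = very_strong_associates, OF _ vs] by simp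
  moreover have "strongly_irreducible_elem a"
    unfolding strongly_irreducible_elem_def
    using nonunit either[where P = strong_associates, OF _ strong] by simp
  moreover have "irreducible_elem a"
    unfolding irreducible_elem_def using nonunit
      either[where P = associates, OF _ strong[THEN strong_associates_imp_associates]] by simp
  ultimately show ?thesis
    using irr m unfolding irreducibility_kinds_def by fast
qed

lemma isomorphic_wrt_imp_homomorphic:
  fixes xs ys :: "'a::comm_ring_1 list"
  assumes rel: "rel \<in> {associates, strong_associates, very_strong_associates}"
    and iso: "isomorphic_wrt rel xs ys"
  shows "homomorphic xs ys"
proof -
  have len: "length xs = length ys"
    using iso by (simp add: isomorphic_wrt_def)
  obtain \<sigma> where \<sigma>: "\<sigma> permutes {..<length xs}"
    and rel_nth: "\<And>i. i < length xs \<Longrightarrow> rel (xs ! i) (ys ! \<sigma> i)"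
    using iso unfolding isomorphic_wrt_def by blast
  have assoc: "associates (xs ! i) (ys ! \<sigma> i)" if "i < length xs" for i
    using rel rel_nth[OF that] strong_associates_imp_associates
      very_strong_associates_imp_associates by auto
  show ?thesis
    unfolding homomorphic_def
  proof (intro conjI ballI)
    fix x assume "x \<in> set xs"
    then obtain i where i: "i < length xs" "x = xs ! i"
      by (auto simp: in_set_conv_nth)
    then have "\<sigma> i < length ys"
      using permutes_in_image[OF \<sigma>, of i] len by simp
    then show "\<exists>y\<in>set ys. associates x y"
      using assoc[OF i(1)] i(2) nth_mem by blast
  next
    fix y assume "y \<in> set ys"
    then obtain j where j: "j < length ys" "y = ys ! j"
      by (auto simp: in_set_conv_nth)
    then obtain i where "i < length xs" "\<sigma> i = j"
      using permutes_image[OF \<sigma>] len by (metis imageE lessThan_iff)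
    then show "\<exists>x\<in>set xs. associates y x"
      using assoc[of i] j by (auto simp: associates_iff_dvd)
  qed
qed


section \<open>Unique factorization domains\<close>

text \<open>The ring \<open>'a\<close> is an integral domain. This is a predicate, and not a type class constraint,
  because it has to be derived from properties of a type that is only known to be a commutative
  ring.\<close>

definition zero_divisor_free :: "'a::comm_ring_1 itself \<Rightarrow> bool" where
  "zero_divisor_free (_ :: 'a itself) \<longleftrightarrow> (\<forall>a b :: 'a. a * b = 0 \<longrightarrow> a = 0 \<or> b = 0)"

lemma zero_divisor_freeD:
  "zero_divisor_free TYPE('a::comm_ring_1) \<Longrightarrow> (a::'a) * b = 0 \<longleftrightarrow> a = 0 \<or> b = 0"
  unfolding zero_divisor_free_def by (metis mult_zero_left mult_zero_right)

lemma zero_divisor_free_cancel: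
  fixes a b c :: "'a::comm_ring_1"
  assumes "zero_divisor_free TYPE('a)" "a * b = a * c" "a \<noteq> 0"
  shows "b = c"
proof -
  have "a * (b - c) = 0" using assms(2) by (simp add: algebra_simps)
  with assms show ?thesis using zero_divisor_freeD by force
qed

text \<open>Every nonzero nonunit is a product of prime elements. For a domain this is equivalent to
  being a UFD, and it avoids any comparison of factorizations.\<close>

definition prime_factorizations_exist :: "'a::comm_ring_1 itself \<Rightarrow> bool" where
  "prime_factorizations_exist (_ :: 'a itself) \<longleftrightarrow>
     (\<forall>a::'a. a \<noteq> 0 \<and> \<not> a dvd 1 \<longrightarrow> (\<exists>ps. (\<forall>p\<in>set ps. prime_elem p) \<and> prod_list ps = a))"

lemma irreducible_elem_in_domain:
  fixes a b c :: "'a::comm_ring_1"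
  assumes dom: "zero_divisor_free TYPE('a)"
    and a: "irreducible_elem a" "a \<noteq> 0" "a = b * c"
  shows "b dvd 1 \<or> c dvd 1"
proof -
  have unit: "y dvd 1" if "a = x * y" "a dvd x" for x y
  proof -
    obtain k where k: "x = a * k" using \<open>a dvd x\<close> ..
    have "a * (k * y) = a * 1"
      using that(1) k by (simp flip: mult.assoc)
    then have "k * y = 1"
      using zero_divisor_free_cancel[OF dom] a(2) by blast
    then show "y dvd 1"
      by (metis dvd_triv_right)
  qed
  have "associates a b \<or> associates a c"
    using a unfolding irreducible_elem_def by blast
  then show ?thesis
    using unit[of b c] unit[of c b] a(3) unfolding associates_iff_dvd by (metis mult.commute)
qed

lemma prime_elem_irreducible_elem:
  assumes "prime_elem p"
  shows "irreducible_elem p"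
  unfolding irreducible_elem_def
proof (intro conjI allI impI)
  show "\<not> p dvd 1" using assms by (simp add: prime_elem_def)
  fix b c assume p: "p = b * c"
  then have "p dvd b \<or> p dvd c" using assms by (metis dvd_refl prime_elem_dvd_mult_iff)
  then show "associates p b \<or> associates p c"
    unfolding associates_iff_dvd using p by auto
qed

lemma irreducible_elem_prime_elem:
  fixes a :: "'a::comm_ring_1"
  assumes dom: "zero_divisor_free TYPE('a)" and pf: "prime_factorizations_exist TYPE('a)"
    and a: "irreducible_elem a" "a \<noteq> 0"
  shows "prime_elem a"
proof -
  have "\<not> a dvd 1" using a by (simp add: irreducible_elem_def)
  then obtain ps where ps: "\<forall>p\<in>set ps. prime_elem p" "prod_list ps = a"
    using pf a unfolding prime_factorizations_exist_def by blast
  with \<open>\<not> a dvd 1\<close> obtain p qs where "ps = p # qs" by (cases ps) auto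
  then have p: "prime_elem p" and a_eq: "a = p * prod_list qs" using ps by auto
  then have "prod_list qs dvd 1"
    using irreducible_elem_in_domain[OF dom a a_eq] by (auto simp: prime_elem_def)
  then have "a dvd x \<longleftrightarrow> p dvd x" for x
    unfolding a_eq by (simp add: mult_unit_dvd_iff_comm_ring)
  then show ?thesis
    using p a(2) by (auto simp: prime_elem_def)
qed

text \<open>Translation to the library's notion: the nonzero elements of a domain form a cancellative
  monoid in which divisibility, units and irreducible elements are those of the ring.\<close>

lemma unique_factorization_domain_iff:
  "unique_factorization_domain TYPE('a::comm_ring_1) \<longleftrightarrow>
     zero_divisor_free TYPE('a) \<and> prime_factorizations_exist TYPE('a)"
proof -
  define R where "R = (ring_of_type_algebra :: 'a ring)"
  define M where "M = mult_of R"
  have R_simps: "carrier R = UNIV" "\<And>x y. x \<otimes>\<^bsub>R\<^esub> y = x * y" "\<one>\<^bsub>R\<^esub> = 1" "\<zero>\<^bsub>R\<^esub> = 0"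
    by (auto simp: R_def ring_of_type_algebra_def)
  have M_simps: "carrier M = - {0}" "\<And>x y. x \<otimes>\<^bsub>M\<^esub> y = x * y" "\<one>\<^bsub>M\<^esub> = 1"
    by (auto simp: M_def R_simps)
  have M_units: "x \<in> Units M \<longleftrightarrow> x dvd 1" for x
    unfolding Units_def M_simps dvd_def by (auto simp: mult.commute;
      metis mult_zero_left mult_zero_right zero_neq_one)
  have M_dvd: "x divides\<^bsub>M\<^esub> y \<longleftrightarrow> x dvd y" if "y \<noteq> 0" for x y
    using that unfolding factor_def M_simps dvd_def by auto
  have M_irreducible: "Divisibility.irreducible M a \<longleftrightarrow> \<not> a dvd 1 \<and> (\<forall>b. b dvd a \<and> \<not> a dvd b \<longrightarrow> b dvd 1)"
    if "a \<noteq> 0" for a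
    using that unfolding Divisibility.irreducible_def properfactor_def M_units M_simps
    by (auto simp: M_dvd)
  have M_prod: "foldr (\<otimes>\<^bsub>M\<^esub>) xs \<one>\<^bsub>M\<^esub> = prod_list xs" for xs
    by (induction xs) (auto simp: M_simps)
  show ?thesis
  proof (intro iffI conjI)
    assume "unique_factorization_domain TYPE('a)"
    then have fd: "factorial_domain R"
      by (simp add: unique_factorization_domain_def R_def)
    then interpret domain R
      by (simp add: factorial_domain_def)
    show dom: "zero_divisor_free TYPE('a)"
      unfolding zero_divisor_free_def using integral by (simp add: R_simps)
    have fm: "factorial_monoid M"
      using fd by (simp add: factorial_domain_def M_def)
    have prime: "prime_elem p" if irr: "Divisibility.irreducible M p" and p: "p \<noteq> 0" for p
      unfolding prime_elem_def
    proof (intro conjI allI impI p)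
      have pr: "Divisibility.prime M p"
        using factorial_monoid.irreducible_prime[OF fm irr] p by (simp add: M_simps)
      then show "\<not> p dvd 1"
        by (simp add: Divisibility.prime_def M_units)
      fix a b assume ab: "p dvd a * b"
      show "p dvd a \<or> p dvd b"
      proof (cases "a = 0 \<or> b = 0")
        case False
        then have "a * b \<noteq> 0"
          using zero_divisor_freeD[OF dom] by blast
        with False ab pr show ?thesis
          by (simp add: Divisibility.prime_def M_simps M_dvd)
      qed auto
    qed
    show "prime_factorizations_exist TYPE('a)"
      unfolding prime_factorizations_exist_def
    proof (intro allI impI)
      fix a :: 'a assume "a \<noteq> 0 \<and> \<not> a dvd 1"
      then obtain fs where fs: "set fs \<subseteq> carrier M" "factors M fs a"
        using factorial_monoid.factors_exist[OF fm, of a] by (auto simp: M_simps M_units)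
      then have "\<forall>p\<in>set fs. prime_elem p" "prod_list fs = a"
        using prime by (auto simp: M_simps(1) M_prod factors_def)
      then show "\<exists>ps. (\<forall>p\<in>set ps. prime_elem p) \<and> prod_list ps = a"
        by blast
    qed
  next
    assume "zero_divisor_free TYPE('a) \<and> prime_factorizations_exist TYPE('a)"
    then have dom: "zero_divisor_free TYPE('a)" and pf: "prime_factorizations_exist TYPE('a)"
      by auto
    have "domain_axioms R"
      using dom by unfold_locales (auto simp: R_simps zero_divisor_free_def)
    then interpret domain R
      unfolding domain_def R_def using cring_from_type_algebra by blast
    have cancel: "comm_monoid_cancel M"
      unfolding M_def by (rule mult_of.comm_monoid_cancel_axioms)
    have prime: "prime_elem p" if "Divisibility.irreducible M p" "p \<noteq> 0" for p
    proof (rule irreducible_elem_prime_elem[OF dom pf _ that(2)])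
      show "irreducible_elem p"
        unfolding irreducible_elem_def associates_iff_dvd
      proof (intro conjI allI impI)
        show "\<not> p dvd 1"
          using that by (simp add: M_irreducible)
        fix b c assume p: "p = b * c"
        have "b dvd p"
          using p by simp
        then have "p dvd b \<or> b dvd 1"
          using that M_irreducible by blast
        then show "p dvd b \<and> b dvd p \<or> p dvd c \<and> c dvd p"
          using p by (auto simp: unit_mult_dvd_iff_comm_ring)
      qed
    qed
    have pm: "primeness_condition_monoid M"
    proof (intro primeness_condition_monoid.intro primeness_condition_monoid_axioms.intro cancel)
      fix p assume "p \<in> carrier M" "Divisibility.irreducible M p"
      then have "prime_elem p" "p \<noteq> 0"
        using prime by (auto simp: M_simps)
      then show "Divisibility.prime M p"
        unfolding Divisibility.prime_def M_simps M_units
      proof (intro conjI ballI impI)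
        show "\<not> p dvd 1"
          using \<open>prime_elem p\<close> by (simp add: prime_elem_def)
        fix a b :: 'a assume ab: "a \<in> - {0}" "b \<in> - {0}" "p divides\<^bsub>M\<^esub> a * b"
        then have "a * b \<noteq> 0"
          using zero_divisor_freeD[OF dom] by blast
        then show "p divides\<^bsub>M\<^esub> a \<or> p divides\<^bsub>M\<^esub> b"
          using ab \<open>prime_elem p\<close> unfolding M_dvd[OF \<open>a * b \<noteq> 0\<close>]
          by (auto simp: M_dvd dest: prime_elem_dvd_multD)
      qed
    qed
    have unique: "essentially_equal M fs fs'"
      if "a \<in> carrier M" "set fs \<subseteq> carrier M" "set fs' \<subseteq> carrier M" "wfactors M fs a"
        "wfactors M fs' a" for a fs fs'
      by (rule primeness_condition_monoid.wfactors_unique[OF pm that(4,5,1,2,3)])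
    have "factorial_monoid M"
    proof (rule comm_monoid_cancel.factorial_monoidI[OF cancel _ unique])
      fix a assume "a \<in> carrier M" "a \<notin> Units M"
      then have a: "a \<noteq> 0" "\<not> a dvd 1"
        by (auto simp: M_simps M_units)
      then obtain ps where ps: "\<forall>p\<in>set ps. prime_elem p" "prod_list ps = a"
        using pf unfolding prime_factorizations_exist_def by blast
      have "Divisibility.irreducible M p" if "p \<in> set ps" for p
      proof -
        have p: "prime_elem p" "p \<noteq> 0"
          using ps that by (auto simp: prime_elem_def)
        have "b dvd 1" if "b dvd p" "\<not> p dvd b" for b
        proof -
          obtain c where c: "p = b * c" using \<open>b dvd p\<close> ..
          then have "b dvd 1 \<or> c dvd 1"
            using irreducible_elem_in_domain[OF dom prime_elem_irreducible_elem] p by blast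
          then show ?thesis
            using c that(2) by (auto simp: mult_unit_dvd_iff_comm_ring)
        qed
        then show ?thesis
          using p by (auto simp: M_irreducible prime_elem_def)
      qed
      moreover have "set ps \<subseteq> carrier M"
        using ps by (auto simp: M_simps prime_elem_def)
      ultimately have "wfactors M ps a"
        using ps(2) a by (auto simp: wfactors_def M_prod associated_def M_dvd)
      with \<open>set ps \<subseteq> carrier M\<close> show "\<exists>fs. set fs \<subseteq> carrier M \<and> wfactors M fs a"
        by blast
    qed blast+
    then show "unique_factorization_domain TYPE('a)"
      unfolding unique_factorization_domain_def
      using domain_axioms by (simp add: factorial_domain_def M_def flip: R_def)
  qed
qed

lemma prime_factorizations_isomorphic:
  fixes xs ys :: "'a::comm_ring_1 list"
  assumes dom: "zero_divisor_free TYPE('a)"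
    and "\<forall>x\<in>set xs. prime_elem x" "\<forall>y\<in>set ys. prime_elem y"
    and "associates (prod_list xs) (prod_list ys)"
  shows "isomorphic_wrt associates xs ys"
proof -
  have "\<exists>zs. mset zs = mset ys \<and> list_all2 associates xs zs"
    using assms(2-)
  proof (induction xs arbitrary: ys)
    case Nil
    then have unit: "prod_list ys dvd 1"
      by (simp add: associates_iff_dvd)
    have "ys = []"
    proof (rule ccontr)
      assume "ys \<noteq> []"
      then obtain y where y: "y \<in> set ys"
        by (meson last_in_set)
      then have "y dvd 1"
        using unit dvd_prod_list dvd_trans by blast
      then show False
        using y Nil.prems by (auto simp: prime_elem_def)
    qed
    then show ?case by auto
  next
    case (Cons x xs)
    have x: "prime_elem x" "x \<noteq> 0"
      using Cons.prems by (auto simp: prime_elem_def)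
    have "x dvd prod_list ys"
      using Cons.prems(3) by (auto simp: associates_iff_dvd dest: dvd_mult_left)
    then obtain y where y: "y \<in> set ys" "x dvd y"
      using prime_elem_dvd_prod_list x(1) by blast
    then obtain u where u: "y = x * u" by (auto elim: dvdE)
    have "prime_elem y" "y \<noteq> 0"
      using y Cons.prems by (auto simp: prime_elem_def)
    then have u_unit: "u dvd 1"
      using irreducible_elem_in_domain[OF dom prime_elem_irreducible_elem _ u] x(1)
      by (auto simp: prime_elem_def)
    then have assoc: "associates x y"
      using u by (auto simp: associates_iff_dvd mult_unit_dvd_iff_comm_ring)
    obtain us vs where ys: "ys = us @ y # vs"
      using y(1) by (meson split_list)
    have "associates (x * prod_list xs) (x * (u * prod_list (us @ vs)))"
      using Cons.prems(3) ys u by (simp add: ac_simps)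
    then have "associates (prod_list xs) (u * prod_list (us @ vs))"
      unfolding associates_iff_dvd dvd_def mult.assoc
      using zero_divisor_free_cancel[OF dom _ x(2)] by meson
    then have "associates (prod_list xs) (prod_list (us @ vs))"
      using u_unit unfolding associates_iff_dvd
      by (metis dvd_mult dvd_refl dvd_trans unit_mult_dvd_iff_comm_ring)
    then obtain zs where "mset zs = mset (us @ vs)" "list_all2 associates xs zs"
      using Cons.IH[of "us @ vs"] Cons.prems ys by auto
    then have "mset (y # zs) = mset ys \<and> list_all2 associates (x # xs) (y # zs)"
      using ys assoc by simp
    then show ?case by blast
  qed
  then obtain zs where zs: "mset zs = mset ys" "list_all2 associates xs zs"
    by blast
  then obtain \<sigma> where \<sigma>: "\<sigma> permutes {..<length ys}" "permute_list \<sigma> ys = zs"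
    by (metis mset_eq_permutation)
  have "length xs = length ys"
    using zs by (metis list_all2_lengthD mset_eq_length)
  then show ?thesis
    using \<sigma> zs(2) permute_list_nth[OF \<sigma>(1)] unfolding isomorphic_wrt_def
    by (metis list_all2_nthD)
qed

lemma UFD_imp_irreducible_factorization:
  assumes dom: "zero_divisor_free TYPE('a::comm_ring_1)" and pf: "prime_factorizations_exist TYPE('a)"
  shows "atomic_wrt (irreducible_elem :: 'a \<Rightarrow> bool)"
    and "factorizations_agree (irreducible_elem :: 'a \<Rightarrow> bool) (isomorphic_wrt associates)"
proof -
  show "atomic_wrt (irreducible_elem :: 'a \<Rightarrow> bool)"
    using pf prime_elem_irreducible_elem
    unfolding atomic_wrt_def prime_factorizations_exist_def factorization_into_def by metis
  show "factorizations_agree (irreducible_elem :: 'a \<Rightarrow> bool) (isomorphic_wrt associates)"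
    unfolding factorizations_agree_def
  proof (intro allI impI, elim conjE)
    fix a :: 'a and xs ys
    assume "a \<noteq> 0" and xs: "factorization_into irreducible_elem a xs"
      and ys: "factorization_into irreducible_elem a ys"
    have prime: "\<forall>z\<in>set zs. prime_elem z" if "factorization_into irreducible_elem a zs" for zs
    proof
      fix z assume "z \<in> set zs"
      with that \<open>a \<noteq> 0\<close> have "z \<noteq> 0" "irreducible_elem z"
        unfolding factorization_into_def using dvd_prod_list by force+
      then show "prime_elem z"
        using irreducible_elem_prime_elem[OF dom pf] by blast
    qed
    show "isomorphic_wrt associates xs ys"
      using prime_factorizations_isomorphic[OF dom prime[OF xs] prime[OF ys]] xs ys
      by (simp add: factorization_into_def associates_def)
  qed
qed

text \<open>In an atomic domain whose factorizations are pairwise homomorphic, an irreducible divisor of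
  a nonzero product \<open>a * b\<close> of nonunits is associated to an irreducible factor of \<open>a\<close> or of \<open>b\<close>.\<close>

lemma homomorphic_factorizations_imp_UFD:
  assumes dom: "zero_divisor_free TYPE('a::comm_ring_1)"
    and irr: "irr \<in> irreducibility_kinds" and atomic: "atomic_wrt (irr :: 'a \<Rightarrow> bool)"
    and hom: "factorizations_agree irr homomorphic"
  shows "prime_factorizations_exist TYPE('a)"
proof -
  have prime: "prime_elem p" if p: "irr p" "p \<noteq> 0" for p
    unfolding prime_elem_def
  proof (intro conjI allI impI p)
    have irreducible: "irreducible_elem p"
      using irreducible_elem_if_kind irr p by blast
    then show nonunit: "\<not> p dvd 1"
      by (simp add: irreducible_elem_def)
    fix a b assume "p dvd a * b"
    then obtain c where c: "a * b = p * c" ..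
    consider "a = 0 \<or> b = 0" | "a dvd 1" | "b dvd 1" | "c dvd 1"
      | "a * b \<noteq> 0" "\<not> a dvd 1" "\<not> b dvd 1" "\<not> c dvd 1"
      using zero_divisor_freeD[OF dom] by blast
    then show "p dvd a \<or> p dvd b"
    proof cases
      case 1
      then show ?thesis by auto
    next
      case 2
      then show ?thesis
        using \<open>p dvd a * b\<close> by (metis dvd_mult_unit_iff_comm_ring mult.commute)
    next
      case 3
      then show ?thesis
        using \<open>p dvd a * b\<close> by (metis dvd_mult_unit_iff_comm_ring)
    next
      case 4
      then obtain v where v: "1 = c * v" ..
      have "p = a * (b * v)"
        using c v by (metis mult.assoc mult.right_neutral)
      then have "p dvd a \<or> p dvd b * v"
        using irreducible unfolding irreducible_elem_def associates_iff_dvd by metis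
      moreover have "v dvd 1"
        using v by (metis dvd_triv_right)
      ultimately show ?thesis
        using dvd_mult_unit_iff_comm_ring by blast
    next
      case 5
      then have "a \<noteq> 0" "b \<noteq> 0" "c \<noteq> 0"
        using c by auto
      then obtain as bs cs where "factorization_into irr a as" "factorization_into irr b bs"
        "factorization_into irr c cs"
        using atomic 5 unfolding atomic_wrt_def by metis
      then have "factorization_into irr (a * b) (as @ bs)" "factorization_into irr (a * b) (p # cs)"
        and as: "prod_list as = a" and bs: "prod_list bs = b"
        using p c by (auto simp: factorization_into_def)
      moreover have "\<not> a * b dvd 1"
        using 5 dvd_mult_left by blast
      ultimately have "homomorphic (p # cs) (as @ bs)"
        using hom 5(1) unfolding factorizations_agree_def by blast
      then obtain q where "q \<in> set as \<union> set bs" "p dvd q"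
        by (auto simp: homomorphic_def associates_iff_dvd)
      then show ?thesis
        using dvd_prod_list[of q] as bs dvd_trans by blast
    qed
  qed
  show ?thesis
    unfolding prime_factorizations_exist_def
  proof (intro allI impI)
    fix a :: 'a assume a: "a \<noteq> 0 \<and> \<not> a dvd 1"
    then obtain xs where xs: "\<forall>x\<in>set xs. irr x" "prod_list xs = a"
      using atomic unfolding atomic_wrt_def factorization_into_def by blast
    have "x \<noteq> 0" if "x \<in> set xs" for x
      using dvd_prod_list[OF that] xs(2) a by auto
    then show "\<exists>ps. (\<forall>p\<in>set ps. prime_elem p) \<and> prod_list ps = a"
      using xs prime by blast
  qed
qed


section \<open>Zero divisors and homomorphic factorizations of polynomials\<close>

lemma lead_coeff_mult_nonzero:
  fixes p q :: "'a::comm_ring_1 poly"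
  assumes "lead_coeff p * lead_coeff q \<noteq> 0"
  shows "degree (p * q) = degree p + degree q" "lead_coeff (p * q) = lead_coeff p * lead_coeff q"
proof -
  have "coeff (p * q) (degree p + degree q) \<noteq> 0"
    using assms by (simp add: coeff_mult_degree_sum)
  then show "degree (p * q) = degree p + degree q"
    using le_degree degree_mult_le order_antisym by blast
  then show "lead_coeff (p * q) = lead_coeff p * lead_coeff q"
    by (simp add: coeff_mult_degree_sum)
qed

lemma monic_mult_eq_0:
  fixes p q :: "'a::comm_ring_1 poly"
  assumes "lead_coeff p = 1" "p * q = 0"
  shows "q = 0"
  using assms coeff_mult_degree_sum[of p q] by simp

text \<open>If \<open>f * g\<close> is constant and \<open>f\<close> is not, the leading coefficient of \<open>f\<close> kills that of \<open>g\<close>;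
  multiplying \<open>g\<close> by it lowers the degree, and this can be repeated.\<close>

lemma lead_coeff_power_kills:
  fixes f g :: "'a::comm_ring_1 poly"
  assumes "f * g = [:d:]" "degree f > 0"
  shows "\<exists>k. smult (lead_coeff f ^ k) g = 0"
  using assms(1)
proof (induction "degree g" arbitrary: g d rule: less_induct)
  case less
  define g' where "g' = smult (lead_coeff f) g"
  have kill: "lead_coeff f * lead_coeff g = 0"
    using coeff_mult_degree_sum[of f g] assms(2) less.prems by (simp add: coeff_eq_0)
  show ?case
  proof (cases "g' = 0")
    case True
    then show ?thesis unfolding g'_def by (metis power_one_right)
  next
    case False
    have "degree g' \<noteq> degree g"
    proof
      assume "degree g' = degree g"
      then have "lead_coeff g' = 0"
        using kill by (simp add: g'_def)
      with False show False by simp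
    qed
    then have "degree g' < degree g"
      using degree_smult_le[of "lead_coeff f" g] by (simp add: g'_def)
    moreover have "f * g' = [:lead_coeff f * d:]"
      using less.prems by (simp add: g'_def)
    ultimately obtain k where "smult (lead_coeff f ^ k) g' = 0"
      using less.hyps by blast
    then have "smult (lead_coeff f ^ Suc k) g = 0"
      by (simp add: g'_def mult.commute)
    then show ?thesis by blast
  qed
qed

lemma lead_coeff_unit_nilpotent:
  fixes f :: "'a::comm_ring_1 poly"
  assumes "f dvd 1" "degree f > 0"
  shows "\<exists>k. lead_coeff f ^ k = 0"
proof -
  obtain g where g: "1 = f * g" using assms(1) ..
  then have "f * g = [:1:]" by (simp add: one_pCons)
  then obtain k where "smult (lead_coeff f ^ k) g = 0"
    using lead_coeff_power_kills assms(2) by blast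
  then have "smult (lead_coeff f ^ k) (f * g) = 0"
    by (metis mult_smult_right mult_zero_right)
  then show ?thesis
    unfolding g[symmetric] by (auto simp: one_pCons)
qed

lemma X_dvd_if_coeff_0:
  fixes p :: "'a::comm_ring_1 poly"
  assumes "coeff p 0 = 0"
  obtains q where "p = [:0, 1:] * q"
  using assms by (cases p) auto

text \<open>Suppose that \<open>b\<close> is not nilpotent, and consider the polynomials \<open>H = 1 + b * X * h\<close> whose
  leading coefficient is a power of \<open>b\<close>. From \<open>a * b = 0\<close> follows \<open>a * H = a\<close>, so a factorization
  of \<open>H\<close> can be appended to one of the constant \<open>a\<close>, and homomorphy makes each factor of \<open>H\<close> an
  associate of a factor of \<open>a\<close>. Since \<open>a\<close> has finitely many factors, some \<open>M\<close> among these
  polynomials is a multiple of every factor of \<open>a\<close> that divides one of them. Then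
  \<open>H = 1 + b * X * M\<close> is such a polynomial and has no nonunit factor in common with \<open>M\<close>, so it would
  have to be a unit, which its leading coefficient rules out.\<close>

lemma zero_divisor_nilpotent:
  fixes a b :: "'a::comm_ring_1" and irr :: "'a poly \<Rightarrow> bool"
  assumes irr: "irr \<in> irreducibility_kinds" and atomic: "atomic_wrt irr"
    and hom: "factorizations_agree irr homomorphic"
    and ab: "a * b = 0" and a: "a \<noteq> 0"
  shows "\<exists>k. b ^ k = 0"
proof (rule ccontr)
  assume "\<nexists>k. b ^ k = 0"
  then have nonnil: "b ^ k \<noteq> 0" for k by blast
  \<comment> \<open>The condition on the leading coefficient keeps \<open>T\<close> closed under products, and the members
    of positive degree nonunits, as long as \<open>b\<close> is not nilpotent.\<close>
  define T where "T M \<longleftrightarrow> (\<exists>h. M = 1 + [:0, b:] * h) \<and> (\<exists>k. lead_coeff M = b ^ k)"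
    for M :: "'a poly"
  have T_1: "T 1"
    unfolding T_def by (metis add_0_right lead_coeff_1 mult_zero_right power_0)
  have T_mult: "T (M * N)" if MN: "T M" "T N" for M N
  proof -
    obtain h h' k k' where h: "M = 1 + [:0, b:] * h" "N = 1 + [:0, b:] * h'"
      and k: "lead_coeff M = b ^ k" "lead_coeff N = b ^ k'"
      using MN unfolding T_def by blast
    have "M * N = 1 + [:0, b:] * (h + h' + [:0, b:] * h * h')"
      unfolding h by (simp only: algebra_simps mult_1_left)
    moreover have "lead_coeff (M * N) = b ^ (k + k')"
      using lead_coeff_mult_nonzero(2)[of M N] k nonnil[of "k + k'"] by (simp add: power_add)
    ultimately show ?thesis unfolding T_def by blast
  qed
  have T_step: "T (1 + [:0, b:] * M)" "degree (1 + [:0, b:] * M) > 0"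
    "\<not> 1 + [:0, b:] * M dvd 1" if M: "T M" for M
  proof -
    let ?H = "1 + [:0, b:] * M"
    obtain k where k: "lead_coeff M = b ^ k"
      using M unfolding T_def by blast
    have c: "coeff ?H (Suc (degree M)) = b ^ Suc k"
      using k by simp
    have "degree ([:0, b:] * M) \<le> Suc (degree M)"
      using degree_mult_le[of "[:0, b:]" M] by (simp split: if_splits)
    then have "degree ?H \<le> Suc (degree M)"
      by (intro degree_add_le) auto
    moreover have "degree ?H \<ge> Suc (degree M)"
      using c nonnil by (intro le_degree) metis
    ultimately have deg: "degree ?H = Suc (degree M)"
      by (rule order_antisym)
    then have lc: "lead_coeff ?H = b ^ Suc k"
      using c by simp
    show "degree ?H > 0" using deg by simp
    show "T ?H" unfolding T_def using lc by blast
    have "lead_coeff ?H ^ j \<noteq> 0" for j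
      unfolding lc using nonnil by (metis power_mult)
    then show "\<not> ?H dvd 1"
      using lead_coeff_unit_nilpotent \<open>degree ?H > 0\<close> by blast
  qed
  have common: "\<exists>M. T M \<and> (\<forall>f\<in>set fs. (\<exists>N. T N \<and> f dvd N) \<longrightarrow> f dvd M)" for fs
  proof (induction fs)
    case Nil
    then show ?case using T_1 by auto
  next
    case (Cons f fs)
    then obtain M where M: "T M" "\<forall>f\<in>set fs. (\<exists>N. T N \<and> f dvd N) \<longrightarrow> f dvd M" by blast
    show ?case
    proof (cases "\<exists>N. T N \<and> f dvd N")
      case True
      then obtain N where "T N" "f dvd N" by blast
      with M T_mult show ?thesis by (intro exI[of _ "N * M"]) auto
    next
      case False
      with M show ?thesis by auto
    qed
  qed
  have "b \<noteq> 0" using nonnil[of 1] by simp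
  have zero: "[:a:] * [:0, b:] = 0"
    using ab by (simp add: mult.commute)
  have const: "[:a:] \<noteq> 0" "\<not> [:a:] dvd 1"
  proof -
    show "[:a:] \<noteq> 0" using a by simp
    show "\<not> [:a:] dvd 1"
    proof
      assume "[:a:] dvd 1"
      then obtain q where "1 = [:a:] * q" ..
      then have "[:0, b:] = [:a:] * [:0, b:] * q"
        by (metis mult.assoc mult.commute mult_1)
      with zero \<open>b \<noteq> 0\<close> show False by simp
    qed
  qed
  then obtain fs where fs: "factorization_into irr [:a:] fs"
    using atomic unfolding atomic_wrt_def by blast
  obtain M where M: "T M" and M_dvd: "\<And>f N. f \<in> set fs \<Longrightarrow> T N \<Longrightarrow> f dvd N \<Longrightarrow> f dvd M"
    using common[of fs] by blast
  define H where "H = 1 + [:0, b:] * M"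
  have absorb: "[:a:] * H = [:a:]"
    unfolding H_def distrib_left mult.assoc[symmetric] zero by simp
  then have "H \<noteq> 0" using const by auto
  then obtain gs where gs: "factorization_into irr H gs"
    using atomic T_step(3)[OF M] unfolding atomic_wrt_def H_def by blast
  have "gs \<noteq> []"
    using gs T_step(3)[OF M] unfolding factorization_into_def H_def by auto
  then obtain g where g: "g \<in> set gs"
    by (meson last_in_set)
  have "factorization_into irr [:a:] (fs @ gs)"
    using fs gs absorb by (auto simp: factorization_into_def)
  then have "homomorphic fs (fs @ gs)"
    using hom const fs unfolding factorizations_agree_def by blast
  then obtain f where f: "f \<in> set fs" "f dvd g" "g dvd f"
    using g by (auto simp: homomorphic_def associates_iff_dvd)
  have "g dvd H"
    using gs g dvd_prod_list by (auto simp: factorization_into_def)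
  then have "f dvd H" using f dvd_trans by blast
  then have "f dvd M"
    using M_dvd[OF f(1)] T_step(1)[OF M] by (simp add: H_def)
  then have "f dvd 1"
    using \<open>f dvd H\<close> unfolding H_def by (metis dvd_add_left_iff dvd_mult)
  then have "g dvd 1" using f dvd_trans by blast
  moreover have "irreducible_elem g"
    using g gs irreducible_elem_if_kind[OF irr] by (auto simp: factorization_into_def)
  ultimately show False by (simp add: irreducible_elem_def)
qed

text \<open>Let \<open>X = f * g\<close>. The lowest coefficients satisfy \<open>f0 * g0 = 0\<close> and \<open>f0 * g1 + f1 * g0 = 1\<close>, so
  \<open>f0 * g1\<close> is idempotent. As it is \<open>0\<close> or \<open>1\<close>, one of \<open>f0\<close> and \<open>g0\<close> vanishes, and \<open>X\<close> can be
  cancelled against the factor that it divides.\<close>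

lemma X_trivial_factors:
  fixes f g :: "'a::comm_ring_1 poly"
  assumes idem: "\<And>e::'a. e * e = e \<Longrightarrow> e = 0 \<or> e = 1"
    and fg: "[:0, 1:] = f * g"
  shows "f dvd 1 \<or> g dvd 1"
proof -
  have unit: "p dvd 1" if pq: "[:0, 1:] = p * q" and q0: "coeff q 0 = 0" for p q :: "'a poly"
  proof -
    obtain h where h: "q = [:0, 1:] * h"
      using X_dvd_if_coeff_0[OF q0] .
    have "[:0, 1:] * (p * h - 1) = p * ([:0, 1:] * h) - [:0, 1:]"
      by (simp only: right_diff_distrib mult.left_commute mult_1_right)
    also have "\<dots> = 0"
      by (simp only: h[symmetric] pq[symmetric] diff_self)
    finally have "[:0, 1:] * (p * h - 1) = 0" .
    then have "p * h - 1 = 0"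
      by (rule monic_mult_eq_0[rotated]) simp
    then show ?thesis
      by (metis dvd_triv_left eq_iff_diff_eq_0)
  qed
  have 0: "coeff f 0 * coeff g 0 = 0"
    using fg by (metis coeff_mult_0 coeff_pCons_0)
  have "coeff (f * g) 1 = 1"
    unfolding fg[symmetric] by simp
  then have 1: "coeff f 0 * coeff g 1 + coeff f 1 * coeff g 0 = 1"
    by (simp add: coeff_mult)
  define e where "e = coeff f 0 * coeff g 1"
  have "e * (coeff f 1 * coeff g 0) = coeff f 0 * coeff g 0 * (coeff f 1 * coeff g 1)"
    by (simp only: e_def ac_simps)
  then have "e * e = e * (e + coeff f 1 * coeff g 0)"
    using 0 by (simp add: distrib_left)
  then have "e * e = e"
    using 1 by (simp add: e_def)
  then consider "e = 0" | "e = 1"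
    using idem by blast
  then show ?thesis
  proof cases
    case 1
    \<comment> \<open>the constant term of \<open>g\<close> is a unit, which kills that of \<open>f\<close>\<close>
    then have "coeff f 0 = coeff f 0 * coeff g 0 * coeff f 1"
      using \<open>coeff f 0 * coeff g 1 + coeff f 1 * coeff g 0 = 1\<close>
      by (metis add_0 e_def mult.assoc mult.commute mult.right_neutral)
    then have "coeff f 0 = 0" using 0 by simp
    then show ?thesis using unit[of g f] fg by (simp add: mult.commute)
  next
    case 2
    then have "coeff g 0 = coeff f 0 * coeff g 0 * coeff g 1"
      unfolding e_def by (metis mult.assoc mult.commute mult.right_neutral)
    then have "coeff g 0 = 0" using 0 by simp
    then show ?thesis using unit[of f g] fg by simp
  qed
qed

lemma monic_linear_trivial_factors:
  fixes f g :: "'a::comm_ring_1 poly"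
  assumes idem: "\<And>e::'a. e * e = e \<Longrightarrow> e = 0 \<or> e = 1"
    and fg: "[:c, 1:] = f * g"
  shows "f dvd 1 \<or> g dvd 1"
proof -
  have shift: "p dvd 1" if "pcompose p [:- c, 1:] dvd 1" for p
  proof -
    obtain q where "1 = pcompose p [:- c, 1:] * q" using \<open>pcompose p [:- c, 1:] dvd 1\<close> ..
    then have "pcompose 1 [:c, 1:] = pcompose (pcompose p [:- c, 1:] * q) [:c, 1:]"
      by simp
    then have "1 = p * pcompose q [:c, 1:]"
      by (simp add: pcompose_mult pcompose_1 pcompose_pCons flip: pcompose_assoc)
    then show ?thesis by (metis dvd_triv_left)
  qed
  have "[:0, 1:] = pcompose [:c, 1:] [:- c, 1:]"
    by (simp add: pcompose_pCons)
  also have "\<dots> = pcompose f [:- c, 1:] * pcompose g [:- c, 1:]"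
    unfolding fg by (rule pcompose_mult)
  finally show ?thesis
    using X_trivial_factors[OF idem] shift by blast
qed

text \<open>Zero divisors are nilpotent, so \<open>0\<close> and \<open>1\<close> are the only idempotents and the polynomials
  \<open>X + c\<close> are irreducible in every sense. If \<open>n\<^sup>2 = 0\<close>, comparing \<open>X * X = (X + n) * (X - n)\<close> shows
  that \<open>X\<close> divides \<open>X + n\<close> or \<open>X - n\<close>, whence \<open>n = 0\<close>.\<close>

lemma coefficients_zero_divisor_free:
  fixes irr :: "'a::comm_ring_1 poly \<Rightarrow> bool"
  assumes irr: "irr \<in> irreducibility_kinds" and atomic: "atomic_wrt irr"
    and hom: "factorizations_agree irr homomorphic"
  shows "zero_divisor_free TYPE('a)"
proof -
  note nilpotent = zero_divisor_nilpotent[OF irr atomic hom]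
  have idem: "e = 0 \<or> e = 1" if e: "e * e = e" for e :: 'a
  proof (rule ccontr)
    assume *: "\<not> (e = 0 \<or> e = 1)"
    have "(1 - e) * e = 0" using e by (simp add: algebra_simps)
    then obtain k where "e ^ k = 0" using nilpotent * by force
    moreover have "e ^ Suc j = e" for j
      by (induction j) (simp_all add: e)
    ultimately show False
      using * by (metis not0_implies_Suc power_0 zero_neq_one mult_1 mult_zero_left)
  qed
  have linear: "irr [:c, 1:]" for c
  proof (rule kind_if_trivial_factors[OF irr])
    show "\<not> [:c, 1:] dvd 1"
      using lead_coeff_unit_nilpotent[of "[:c, 1:]"] by auto
    show "[:c, 1:] * r = 0 \<Longrightarrow> r = 0" for r
      by (rule monic_mult_eq_0[of "[:c, 1:]"]) simp_all
  qed (rule monic_linear_trivial_factors[OF idem])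
  have square: "n = 0" if n: "n * n = 0" for n :: 'a
  proof -
    let ?P = "[:0, 1:] * [:0, 1:] :: 'a poly"
    have "factorization_into irr ?P [[:0, 1:], [:0, 1:]]"
      "factorization_into irr ?P [[:n, 1:], [:- n, 1:]]"
      using linear n by (auto simp: factorization_into_def)
    moreover have "?P \<noteq> 0" "\<not> ?P dvd 1"
      using lead_coeff_unit_nilpotent[of ?P] by auto
    ultimately have "homomorphic [[:0, 1:], [:0, 1:]] [[:n, 1:], [:- n, 1:]]"
      using hom unfolding factorizations_agree_def by blast
    then have "[:0, 1:] dvd [:n, 1:] \<or> [:0, 1:] dvd [:- n, 1:]"
      by (auto simp: homomorphic_def associates_iff_dvd)
    moreover have "c = 0" if "[:0, 1:] dvd [:c, 1:]" for c :: 'a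
      using that poly_eq_0_iff_dvd[of "[:c, 1:]" 0] by simp
    ultimately show ?thesis by fastforce
  qed
  have reduced: "b = 0" if "b ^ k = 0" for b :: 'a and k
    using that
  proof (induction k)
    case 0
    then show ?case by simp
  next
    case (Suc k)
    show ?case
    proof (cases k)
      case 0
      then show ?thesis using Suc.prems by simp
    next
      case (Suc m)
      have "b ^ k * b ^ k = b ^ Suc k * b ^ m"
        unfolding Suc by (simp add: ac_simps)
      also have "b ^ Suc k * b ^ m = 0"
        using Suc.prems by simp
      finally have "b ^ k = 0"
        by (rule square)
      then show ?thesis by (rule Suc.IH)
    qed
  qed
  show ?thesis
    unfolding zero_divisor_free_def
  proof (intro allI impI)
    fix a b :: 'a assume "a * b = 0"
    then have "\<exists>k. b ^ k = 0" if "a \<noteq> 0"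
      using nilpotent that by blast
    then show "a = 0 \<or> b = 0"
      using reduced by blast
  qed
qed


lemma prime_factorizations_exist_iff_unit:
  "prime_factorizations_exist TYPE('a::comm_ring_1) \<longleftrightarrow>
     (\<forall>a::'a. a \<noteq> 0 \<longrightarrow>
       (\<exists>u ps. u dvd 1 \<and> (\<forall>p\<in>set ps. prime_elem p) \<and> a = u * prod_list ps))"
  (is "?L \<longleftrightarrow> ?R")
proof
  assume ?L
  show ?R
  proof (intro allI impI)
    fix a :: 'a assume a: "a \<noteq> 0"
    show "\<exists>u ps. u dvd 1 \<and> (\<forall>p\<in>set ps. prime_elem p) \<and> a = u * prod_list ps"
    proof (cases "a dvd 1")
      case True
      then show ?thesis by (intro exI[of _ a] exI[of _ "[]"]) simp
    next
      case False
      then obtain ps where "\<forall>p\<in>set ps. prime_elem p" "prod_list ps = a"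
        using \<open>?L\<close> a unfolding prime_factorizations_exist_def by blast
      then show ?thesis by (intro exI[of _ 1] exI[of _ ps]) simp
    qed
  qed
next
  assume ?R
  show ?L
    unfolding prime_factorizations_exist_def
  proof (intro allI impI)
    fix a :: 'a assume a: "a \<noteq> 0 \<and> \<not> a dvd 1"
    then obtain u ps where u: "u dvd 1" and ps: "\<forall>p\<in>set ps. prime_elem p" "a = u * prod_list ps"
      using \<open>?R\<close> by blast
    show "\<exists>ps. (\<forall>p\<in>set ps. prime_elem p) \<and> prod_list ps = a"
    proof (cases ps)
      case Nil
      then show ?thesis using a u ps by simp
    next
      case (Cons p qs)
      obtain v where "1 = u * v" using u ..
      then have "u \<noteq> 0" and "v * (u * p) = p" by (auto simp: ac_simps)
      then have "u * p \<noteq> 0" if "p \<noteq> 0" using that by auto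
      then have "prime_elem (u * p)"
        using ps(1) Cons u by (simp add: prime_elem_def unit_mult_dvd_iff_comm_ring)
      then show ?thesis
        using ps Cons by (intro exI[of _ "u * p # qs"]) (simp add: mult.assoc)
    qed
  qed
qed

section \<open>Polynomials over a unique factorization domain\<close>

lemma lead_coeff_mult_domain:
  fixes p q :: "'a::comm_ring_1 poly"
  assumes "zero_divisor_free TYPE('a)" "p \<noteq> 0" "q \<noteq> 0"
  shows "degree (p * q) = degree p + degree q" "lead_coeff (p * q) = lead_coeff p * lead_coeff q"
    "p * q \<noteq> 0"
proof -
  have nz: "lead_coeff p * lead_coeff q \<noteq> 0"
    using assms by (simp add: zero_divisor_freeD)
  show "degree (p * q) = degree p + degree q"
    and lc: "lead_coeff (p * q) = lead_coeff p * lead_coeff q"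
    using lead_coeff_mult_nonzero[OF nz] by blast+
  then show "p * q \<noteq> 0"
    using nz by fastforce
qed

lemma zero_divisor_free_poly_iff:
  "zero_divisor_free TYPE('a::comm_ring_1 poly) \<longleftrightarrow> zero_divisor_free TYPE('a)"
proof
  assume dom: "zero_divisor_free TYPE('a poly)"
  show "zero_divisor_free TYPE('a)"
    unfolding zero_divisor_free_def
  proof (intro allI impI)
    fix a b :: 'a assume "a * b = 0"
    then have "[:a:] * [:b:] = 0" by (simp add: mult.commute)
    then have "[:a:] = 0 \<or> [:b:] = 0" using zero_divisor_freeD[OF dom] by blast
    then show "a = 0 \<or> b = 0" by simp
  qed
next
  assume "zero_divisor_free TYPE('a)"
  then show "zero_divisor_free TYPE('a poly)"
    unfolding zero_divisor_free_def[where 'a = "'a poly"] using lead_coeff_mult_domain(3) by blast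
qed

lemma unit_poly_degree:
  fixes p :: "'a::comm_ring_1 poly"
  assumes dom: "zero_divisor_free TYPE('a)" and "p dvd 1"
  shows "degree p = 0"
proof -
  obtain q where q: "1 = p * q" using assms(2) ..
  then have "p \<noteq> 0" "q \<noteq> 0" by auto
  then show ?thesis
    using lead_coeff_mult_domain(1)[OF dom, of p q] q[symmetric] by simp
qed

lemma const_poly_dvd_iff_comm_ring:
  fixes c :: "'a::comm_ring_1"
  shows "[:c:] dvd p \<longleftrightarrow> (\<forall>n. c dvd coeff p n)"
proof
  show "[:c:] dvd p \<Longrightarrow> \<forall>n. c dvd coeff p n"
    by (auto elim!: dvdE)
  show "\<forall>n. c dvd coeff p n \<Longrightarrow> [:c:] dvd p"
  proof (induction p)
    case 0
    then show ?case by simp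
  next
    case (pCons a p)
    have "c dvd coeff p n" for n
      using pCons.prems[rule_format, of "Suc n"] by simp
    then obtain q where q: "p = [:c:] * q" using pCons.IH by (auto elim: dvdE)
    have "c dvd a" using pCons.prems[rule_format, of 0] by simp
    then obtain d where "a = c * d" ..
    then have "pCons a p = [:c:] * pCons d q" using q by simp
    then show ?case by (metis dvd_triv_left)
  qed
qed

lemma const_poly_dvd_const_poly_iff_comm_ring:
  fixes c d :: "'a::comm_ring_1"
  shows "[:c:] dvd [:d:] \<longleftrightarrow> c dvd d"
  unfolding const_poly_dvd_iff_comm_ring by (auto simp: coeff_pCons split: nat.splits)

lemma const_poly_unit_iff:
  fixes c :: "'a::comm_ring_1"
  shows "[:c:] dvd 1 \<longleftrightarrow> c dvd 1"
  using const_poly_dvd_const_poly_iff_comm_ring[of c 1] by (simp add: one_pCons)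

lemma prime_elem_const_poly_iff_comm_ring:
  fixes c :: "'a::comm_ring_1"
  shows "prime_elem [:c:] \<longleftrightarrow> prime_elem c"
proof
  assume c: "prime_elem [:c:]"
  show "prime_elem c"
    unfolding prime_elem_def
  proof (intro conjI allI impI)
    show "c \<noteq> 0" "\<not> c dvd 1"
      using c by (auto simp: prime_elem_def const_poly_unit_iff)
    fix a b assume "c dvd a * b"
    then have "[:c:] dvd [:a:] * [:b:]"
      using const_poly_dvd_const_poly_iff_comm_ring[of c "a * b"] by (simp add: mult.commute)
    then have "[:c:] dvd [:a:] \<or> [:c:] dvd [:b:]"
      using c prime_elem_dvd_mult_iff by blast
    then show "c dvd a \<or> c dvd b"
      by (simp only: const_poly_dvd_const_poly_iff_comm_ring)
  qed
next
  assume c: "prime_elem c"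
  show "prime_elem [:c:]"
    unfolding prime_elem_def
  proof (intro conjI allI impI)
    show "[:c:] \<noteq> 0" "\<not> [:c:] dvd 1"
      using c by (auto simp: prime_elem_def const_poly_unit_iff)
    fix a b assume ab: "[:c:] dvd a * b"
    show "[:c:] dvd a \<or> [:c:] dvd b"
    proof (rule ccontr)
      assume "\<not> ([:c:] dvd a \<or> [:c:] dvd b)"
      then have ex: "\<exists>n. \<not> c dvd coeff a n" "\<exists>m. \<not> c dvd coeff b m"
        by (auto simp: const_poly_dvd_iff_comm_ring)
      \<comment> \<open>compare coefficients at the sum of the least indices that \<open>c\<close> does not divide\<close>
      define n where "n = (LEAST n. \<not> c dvd coeff a n)"
      define m where "m = (LEAST m. \<not> c dvd coeff b m)"
      have n: "\<not> c dvd coeff a n" "\<And>i. i < n \<Longrightarrow> c dvd coeff a i"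
        unfolding n_def using LeastI_ex[OF ex(1)] by (assumption, metis not_less_Least)
      have m: "\<not> c dvd coeff b m" "\<And>i. i < m \<Longrightarrow> c dvd coeff b i"
        unfolding m_def using LeastI_ex[OF ex(2)] by (assumption, metis not_less_Least)
      let ?t = "\<lambda>i. coeff a i * coeff b (n + m - i)"
      have "coeff (a * b) (n + m) = ?t n + (\<Sum>i\<in>{..n + m} - {n}. ?t i)"
        unfolding coeff_mult by (rule sum.remove) auto
      moreover have "c dvd (\<Sum>i\<in>{..n + m} - {n}. ?t i)"
      proof (rule dvd_sum)
        fix i assume i: "i \<in> {..n + m} - {n}"
        then consider "i < n" | "n + m - i < m" by fastforce
        then show "c dvd ?t i"
          by cases (use n(2) m(2) in auto)
      qed
      moreover have "c dvd coeff (a * b) (n + m)"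
        using ab by (simp add: const_poly_dvd_iff_comm_ring)
      ultimately have "c dvd coeff a n * coeff b m"
        by (simp add: dvd_add_left_iff)
      then show False
        using c n(1) m(1) by (auto simp: prime_elem_dvd_mult_iff)
    qed
  qed
qed

text \<open>A polynomial is called primitive if no prime constant divides it. This needs no greatest
  common divisors, and agrees with the usual notion for nonzero polynomials over a UFD. The zero
  polynomial is primitive exactly if the coefficient ring has no prime elements.\<close>

definition primitive_poly :: "'a::comm_ring_1 poly \<Rightarrow> bool" where
  "primitive_poly f \<longleftrightarrow> (\<forall>p. prime_elem p \<longrightarrow> \<not> [:p:] dvd f)"

lemma primitive_poly_dvd: "primitive_poly f \<Longrightarrow> g dvd f \<Longrightarrow> primitive_poly g"
  unfolding primitive_poly_def using dvd_trans by blast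

context
  assumes dom: "zero_divisor_free TYPE('a::comm_ring_1)"
    and pf: "prime_factorizations_exist TYPE('a)"
begin

private lemma dom_poly: "zero_divisor_free TYPE('a poly)"
  using dom zero_divisor_free_poly_iff by blast

private lemma unit_times_primes:
  fixes a :: 'a
  assumes "a \<noteq> 0"
  obtains u ps where "u dvd 1" "\<forall>p\<in>set ps. prime_elem p" "a = u * prod_list ps"
  using pf assms unfolding prime_factorizations_exist_iff_unit by metis

private lemma primitive_part_exists:
  fixes f :: "'a poly"
  assumes "f \<noteq> 0"
  obtains c g where "c \<noteq> 0" "f = [:c:] * g" "primitive_poly g"
proof -
  have "\<exists>c g. c \<noteq> 0 \<and> f = [:c:] * g \<and> primitive_poly g"
    if "f \<noteq> 0" "u dvd 1" "\<forall>p\<in>set ps. prime_elem p" "lead_coeff f = u * prod_list ps"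
    for f :: "'a poly" and u ps
    using that
    \<comment> \<open>each prime constant taken out of \<open>f\<close> removes one prime from its leading coefficient\<close>
  proof (induction "length ps" arbitrary: f u ps)
    case 0
    have "primitive_poly f"
      unfolding primitive_poly_def
    proof (intro allI impI notI)
      fix p :: 'a assume p: "prime_elem p" "[:p:] dvd f"
      then have "p dvd lead_coeff f" by (simp add: const_poly_dvd_iff_comm_ring)
      then have "p dvd u" using 0 by simp
      then have "p dvd 1" using \<open>u dvd 1\<close> by (rule dvd_trans)
      with p show False by (simp add: prime_elem_def)
    qed
    then show ?case by (intro exI[of _ 1] exI[of _ f]) (simp add: one_pCons[symmetric])
  next
    case (Suc n)
    show ?case
    proof (cases "primitive_poly f")
      case True
      then show ?thesis by (intro exI[of _ 1] exI[of _ f]) (simp add: one_pCons[symmetric])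
    next
      case False
      then obtain p k where p: "prime_elem p" and k: "f = [:p:] * k"
        unfolding primitive_poly_def by (auto elim: dvdE)
      have p0: "p \<noteq> 0" using p by (simp add: prime_elem_def)
      have k0: "k \<noteq> 0" using k Suc.prems by auto
      have lc: "lead_coeff f = p * lead_coeff k"
        using lead_coeff_mult_domain(2)[OF dom _ k0, of "[:p:]"] p0 k by simp
      have "\<not> p dvd u" using p Suc.prems(2) dvd_trans by (auto simp: prime_elem_def)
      moreover have "p dvd u * prod_list ps" using lc Suc.prems(4) by (metis dvd_triv_left)
      ultimately have "p dvd prod_list ps" using p by (simp add: prime_elem_dvd_mult_iff)
      then obtain q where q: "q \<in> set ps" "p dvd q" using prime_elem_dvd_prod_list p by blast
      then obtain v where v: "q = p * v" by (auto elim: dvdE)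
      have "prime_elem q" using q Suc.prems by blast
      then have "v dvd 1"
        using irreducible_elem_in_domain[OF dom prime_elem_irreducible_elem _ v] p
        by (auto simp: prime_elem_def)
      obtain us vs where ps: "ps = us @ q # vs" using q by (meson split_list)
      have "p * lead_coeff k = p * (u * v * prod_list (us @ vs))"
        using lc Suc.prems(4) ps v by (simp add: ac_simps)
      then have "lead_coeff k = u * v * prod_list (us @ vs)"
        using zero_divisor_free_cancel[OF dom _ p0] by blast
      moreover have "u * v dvd 1" using \<open>u dvd 1\<close> \<open>v dvd 1\<close>
        by (simp add: mult_unit_dvd_iff_comm_ring)
      moreover have "n = length (us @ vs)" "\<forall>p\<in>set (us @ vs). prime_elem p"
        using Suc.hyps(2) Suc.prems(3) ps by auto
      ultimately obtain c g where cg: "c \<noteq> 0" "k = [:c:] * g" "primitive_poly g"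
        using Suc.hyps(1)[of "us @ vs" k "u * v"] k0 by blast
      then have "f = [:p * c:] * g" using k by (simp add: mult.commute)
      moreover have "p * c \<noteq> 0" using p0 cg(1) zero_divisor_freeD[OF dom] by blast
      ultimately show ?thesis using cg(3) by blast
    qed
  qed
  moreover obtain u ps where "u dvd 1" "\<forall>p\<in>set ps. prime_elem p" "lead_coeff f = u * prod_list ps"
    using unit_times_primes[of "lead_coeff f"] assms by auto
  ultimately show ?thesis using assms that by metis
qed

text \<open>The primes of \<open>c\<close> remain prime as constant polynomials, do not divide \<open>g\<close>, and can therefore
  be cancelled one at a time.\<close>

private lemma primitive_dvd_const_mult:
  fixes f g :: "'a poly"
  assumes g: "primitive_poly g" and c: "c \<noteq> 0" and dvd: "g dvd [:c:] * f"
  shows "g dvd f"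
proof -
  obtain u ps where u: "u dvd 1" and ps: "\<forall>p\<in>set ps. prime_elem p" "c = u * prod_list ps"
    using unit_times_primes c by blast
  have "g dvd [:u * prod_list ps:] * f \<Longrightarrow> g dvd f"
    using ps(1)
  proof (induction ps)
    case Nil
    then show ?case
      using u dvd_mult_unit_iff_comm_ring[of "[:u:]" g f]
      by (simp add: const_poly_unit_iff mult.commute)
  next
    case (Cons p ps)
    let ?k = "[:u * prod_list ps:] * f"
    have p: "prime_elem [:p:]" using Cons.prems by (simp add: prime_elem_const_poly_iff_comm_ring)
    have "[:u * prod_list (p # ps):] * f = [:p:] * ?k" by (simp add: ac_simps)
    then obtain q where q: "[:p:] * ?k = g * q" using Cons.prems(1) by (auto elim: dvdE)
    then have "[:p:] dvd g * q" by (metis dvd_triv_left)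
    then have "[:p:] dvd q"
      using p g Cons.prems(2) by (auto simp: primitive_poly_def prime_elem_dvd_mult_iff)
    then obtain r where "q = [:p:] * r" ..
    then have "[:p:] * ?k = [:p:] * (g * r)" using q by (simp only: mult.left_commute)
    moreover have "[:p:] \<noteq> 0" using p by (simp add: prime_elem_def)
    ultimately have "?k = g * r"
      by (rule zero_divisor_free_cancel[OF dom_poly])
    then have "g dvd ?k" by (metis dvd_triv_left)
    then show ?case using Cons by simp
  qed
  then show ?thesis using dvd ps(2) by blast
qed

private lemma primitive_nonunit_degree:
  fixes f :: "'a poly"
  assumes "primitive_poly f" "f \<noteq> 0" "\<not> f dvd 1"
  shows "degree f > 0"
proof (rule ccontr)
  assume "\<not> degree f > 0"
  then obtain c where c: "f = [:c:]" using degree_eq_zeroE by blast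
  then have "c \<noteq> 0" "\<not> c dvd 1" using assms by (auto simp: const_poly_unit_iff)
  then obtain ps where "\<forall>p\<in>set ps. prime_elem p" "prod_list ps = c"
    using pf unfolding prime_factorizations_exist_def by blast
  moreover from this \<open>\<not> c dvd 1\<close> obtain p where "p \<in> set ps" by (cases ps) auto
  ultimately show False
    using assms(1) c dvd_prod_list
    by (auto simp: primitive_poly_def const_poly_dvd_const_poly_iff_comm_ring)
qed

text \<open>A form of Gauss's lemma that needs no fraction field. A nonzero element \<open>d\<close> of least degree in
  the ideal generated by \<open>f\<close> and \<open>g\<close> divides both up to nonzero constants, so its primitive part
  divides both. If \<open>f\<close> is irreducible and does not divide \<open>g\<close>, that part is a unit, so the ideal
  contains a nonzero constant \<open>c\<close>. Then \<open>f\<close> divides \<open>c * h\<close>, and hence \<open>h\<close>, whenever it divides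
  \<open>g * h\<close>.\<close>

private lemma irreducible_poly_prime:
  fixes f :: "'a poly"
  assumes irr: "irreducible_elem f" and deg: "degree f > 0"
  shows "prime_elem f"
proof -
  have f0: "f \<noteq> 0" using deg by auto
  have nonunit: "\<not> f dvd 1" using irr by (simp add: irreducible_elem_def)
  note factors = irreducible_elem_in_domain[OF dom_poly irr f0]
  have prim: "primitive_poly f"
    unfolding primitive_poly_def
  proof (intro allI impI notI)
    fix p :: 'a assume p: "prime_elem p" "[:p:] dvd f"
    then obtain k where k: "f = [:p:] * k" by (auto elim: dvdE)
    moreover have "\<not> [:p:] dvd 1" using p by (simp add: const_poly_unit_iff prime_elem_def)
    ultimately have "k dvd 1" using factors by blast
    then have "degree k = 0" by (rule unit_poly_degree[OF dom])
    then show False using deg k degree_mult_le[of "[:p:]" k] by simp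
  qed
  have "f dvd h" if gh: "f dvd g * h" and g: "\<not> f dvd g" for g h
  proof -
    define I where "I = {u * f + v * g | u v. True}"
    have I_mult: "x * a - y * b \<in> I" if xyI: "x \<in> I" "y \<in> I" for x y a b
    proof -
      obtain u v u' v' where xy: "x = u * f + v * g" "y = u' * f + v' * g"
        using xyI unfolding I_def by blast
      have "x * a - y * b = (u * a - u' * b) * f + (v * a - v' * b) * g"
        unfolding xy by (simp add: algebra_simps)
      then show ?thesis unfolding I_def by blast
    qed
    have "f = 1 * f + 0 * g" "g = 0 * f + 1 * g" by auto
    then have fI: "f \<in> I" and gI: "g \<in> I" unfolding I_def by blast+
    obtain d where d: "d \<in> I" "d \<noteq> 0" and least: "\<And>x. x \<in> I \<Longrightarrow> x \<noteq> 0 \<Longrightarrow> degree d \<le> degree x"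
      using ex_has_least_nat[of "\<lambda>x. x \<in> I \<and> x \<noteq> 0" f degree] fI f0 by blast
    obtain c d0 where c: "c \<noteq> 0" "d = [:c:] * d0" and d0: "primitive_poly d0"
      using primitive_part_exists[OF d(2)] by blast
    have power_nonzero: "a ^ n \<noteq> 0" if "a \<noteq> 0" for a :: 'a and n
      using that by (induction n) (auto simp: zero_divisor_freeD[OF dom])
    have "d0 dvd x" if x: "x \<in> I" for x
    proof -
      obtain q r where qr: "pseudo_divmod x d = (q, r)" by fastforce
      define l where "l = lead_coeff d ^ (Suc (degree x) - degree d)"
      \<comment> \<open>pseudo-division; the remainder lies in \<open>I\<close>, so it vanishes by minimality of \<open>d\<close>\<close>
      have eq: "smult l x = d * q + r" and r: "r = 0 \<or> degree r < degree d"
        unfolding l_def using pseudo_divmod[OF d(2) qr] by blast+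
      have "r = x * [:l:] - d * q" using eq by simp
      then have "r \<in> I" using I_mult[OF x d(1), of "[:l:]" q] by simp
      then have "r = 0" using r least by fastforce
      then have "[:l:] * x = d0 * ([:c:] * q)" using eq c(2) by (simp add: ac_simps)
      then have "d0 dvd [:l:] * x" by (metis dvd_triv_left)
      moreover have "l \<noteq> 0" unfolding l_def using power_nonzero d(2) by simp
      ultimately show ?thesis using primitive_dvd_const_mult d0 by blast
    qed
    then have "d0 dvd f" "d0 dvd g" using fI gI by auto
    then obtain e where e: "f = d0 * e" by (auto elim: dvdE)
    have "\<not> e dvd 1"
      using e g \<open>d0 dvd g\<close> by (metis dvd_refl dvd_trans mult_unit_dvd_iff_comm_ring)
    then have "d0 dvd 1" using factors[OF e] by blast
    then obtain w where w: "1 = d0 * w" ..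
    obtain u v where uv: "d = u * f + v * g" using d(1) unfolding I_def by blast
    have "[:c:] * h = d * w * h" using c(2) w by (metis mult.assoc mult.right_neutral)
    also have "\<dots> = f * (u * w * h) + (g * h) * (v * w)"
      unfolding uv by (simp only: algebra_simps)
    finally have "f dvd [:c:] * h" using gh by (metis dvd_add dvd_mult2 dvd_triv_left)
    then show "f dvd h" using primitive_dvd_const_mult[OF prim c(1)] by blast
  qed
  then show ?thesis using f0 nonunit unfolding prime_elem_def by blast
qed

private lemma primitive_prime_factorization:
  fixes f :: "'a poly"
  assumes "primitive_poly f" "f \<noteq> 0" "\<not> f dvd 1"
  shows "\<exists>ps. (\<forall>p\<in>set ps. prime_elem p) \<and> f = prod_list ps"
  using assms
proof (induction "degree f" arbitrary: f rule: less_induct)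
  case less
  have deg: "degree f > 0" using primitive_nonunit_degree less.prems by blast
  show ?case
  proof (cases "irreducible_elem f")
    case True
    then show ?thesis
      using irreducible_poly_prime deg by (intro exI[of _ "[f]"]) simp
  next
    case False
    then obtain b c where f: "f = b * c" and "\<not> associates f b" "\<not> associates f c"
      using less.prems by (auto simp: irreducible_elem_def)
    then have units: "\<not> b dvd 1" "\<not> c dvd 1"
      by (auto simp: associates_iff_dvd mult_unit_dvd_iff_comm_ring unit_mult_dvd_iff_comm_ring)
    have nz: "b \<noteq> 0" "c \<noteq> 0" using f less.prems by auto
    have prim: "primitive_poly b" "primitive_poly c"
      using primitive_poly_dvd[of f b] primitive_poly_dvd[of f c] less.prems(1) f by simp_all
    have "degree f = degree b + degree c" unfolding f by (rule lead_coeff_mult_domain(1)[OF dom nz])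
    moreover have "degree b > 0" "degree c > 0"
      using primitive_nonunit_degree prim nz units by blast+
    ultimately obtain ps qs where "\<forall>p\<in>set ps. prime_elem p" "b = prod_list ps"
      "\<forall>p\<in>set qs. prime_elem p" "c = prod_list qs"
      using less.hyps[of b] less.hyps[of c] prim nz units by auto
    then show ?thesis using f by (intro exI[of _ "ps @ qs"]) auto
  qed
qed

lemma prime_factorizations_exist_poly: "prime_factorizations_exist TYPE('a poly)"
  unfolding prime_factorizations_exist_iff_unit
proof (intro allI impI)
  fix f :: "'a poly" assume "f \<noteq> 0"
  then obtain c g where c: "c \<noteq> 0" and f: "f = [:c:] * g" and g: "primitive_poly g"
    using primitive_part_exists by blast
  obtain u ps where u: "u dvd 1" and ps: "\<forall>p\<in>set ps. prime_elem p" "c = u * prod_list ps"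
    using unit_times_primes[OF c] by blast
  have const: "[:prod_list ps:] = prod_list (map (\<lambda>p. [:p:]) ps)"
  proof (induction ps)
    case Nil
    then show ?case by (simp add: one_pCons)
  next
    case (Cons p ps)
    have "[:prod_list (p # ps):] = [:p:] * [:prod_list ps:]" by simp
    then show ?case by (simp only: Cons.IH list.map prod_list.Cons)
  qed
  have "\<exists>v qs. v dvd 1 \<and> (\<forall>q\<in>set qs. prime_elem q) \<and> g = v * prod_list qs"
  proof (cases "g dvd 1")
    case True
    then show ?thesis by (intro exI[of _ g] exI[of _ "[]"]) simp
  next
    case False
    moreover have "g \<noteq> 0" using f \<open>f \<noteq> 0\<close> by auto
    ultimately obtain qs where "\<forall>q\<in>set qs. prime_elem q" "g = prod_list qs"
      using primitive_prime_factorization g by blast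
    then show ?thesis by (intro exI[of _ 1] exI[of _ qs]) simp
  qed
  then obtain v qs where v: "v dvd 1" and qs: "\<forall>q\<in>set qs. prime_elem q" "g = v * prod_list qs"
    by blast
  have "f = [:u:] * [:prod_list ps:] * g"
    using f ps(2) by (simp add: mult.commute)
  then have "f = ([:u:] * v) * prod_list (map (\<lambda>p. [:p:]) ps @ qs)"
    unfolding const qs(2) by (simp only: prod_list.append ac_simps)
  moreover have "[:u:] * v dvd 1"
    using u v by (simp add: const_poly_unit_iff mult_unit_dvd_iff_comm_ring del: mult_pCons_left)
  moreover have "\<forall>p\<in>set (map (\<lambda>p. [:p:]) ps @ qs). prime_elem p"
    using ps(1) qs(1) by (auto simp: prime_elem_const_poly_iff_comm_ring)
  ultimately show "\<exists>u ps. u dvd 1 \<and> (\<forall>p\<in>set ps. prime_elem p) \<and> f = u * prod_list ps"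
    by blast
qed

end

lemma prime_factorizations_exist_coefficients:
  assumes dom: "zero_divisor_free TYPE('a::comm_ring_1)"
    and pf: "prime_factorizations_exist TYPE('a poly)"
  shows "prime_factorizations_exist TYPE('a)"
  unfolding prime_factorizations_exist_def
proof (intro allI impI)
  fix c :: 'a assume c: "c \<noteq> 0 \<and> \<not> c dvd 1"
  then have "[:c:] \<noteq> 0 \<and> \<not> [:c:] dvd 1"
    by (simp add: const_poly_unit_iff)
  then obtain ps where ps: "\<forall>p\<in>set ps. prime_elem p" "prod_list ps = [:c:]"
    using pf unfolding prime_factorizations_exist_def by blast
  have "prime_elem (coeff p 0)" if p: "p \<in> set ps" for p
  proof -
    obtain q where q: "[:c:] = p * q" using dvd_prod_list[OF p] ps(2) by (auto elim: dvdE)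
    then have "p \<noteq> 0" "q \<noteq> 0" using c by auto
    then have "degree p = 0"
      using lead_coeff_mult_domain(1)[OF dom, of p q] q[symmetric] by simp
    then obtain d where "p = [:d:]" using degree_eq_zeroE by blast
    then show ?thesis using ps(1) p by (auto simp: prime_elem_const_poly_iff_comm_ring)
  qed
  moreover have "coeff (prod_list ps) 0 = prod_list (map (\<lambda>p. coeff p 0) ps)" for ps :: "'a poly list"
    by (induction ps) (simp_all add: coeff_mult_0)
  then have "prod_list (map (\<lambda>p. coeff p 0) ps) = c"
    using ps(2) by (metis coeff_pCons_0)
  ultimately show "\<exists>ps. (\<forall>p\<in>set ps. prime_elem p) \<and> prod_list ps = c"
    by (intro exI[of _ "map (\<lambda>p. coeff p 0) ps"]) auto
qed

lemma unique_factorization_domain_poly_iff: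
  "unique_factorization_domain TYPE('a::comm_ring_1 poly) \<longleftrightarrow> unique_factorization_domain TYPE('a)"
  unfolding unique_factorization_domain_iff zero_divisor_free_poly_iff
  using prime_factorizations_exist_poly prime_factorizations_exist_coefficients by blast

section \<open>Unique factorization in polynomial rings\<close>

theorem corollary5p5:
  shows "(unique_factorization_domain TYPE('a::comm_ring_1 poly) \<longleftrightarrow>
            unique_factorization_domain TYPE('a)) \<and>
         (unique_factorization_domain TYPE('a poly) \<longleftrightarrow>
            unique_factorization_ring TYPE('a poly)) \<and>
         (unique_factorization_ring TYPE('a poly) \<longleftrightarrow>
            atomic_wrt (irreducible_elem :: 'a poly \<Rightarrow> bool) \<and>
            factorizations_agree (irreducible_elem :: 'a poly \<Rightarrow> bool) homomorphic)"
proof -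
  let ?UFD = "unique_factorization_domain TYPE('a poly)"
  let ?UFR = "unique_factorization_ring TYPE('a poly)"
  let ?hom = "atomic_wrt (irreducible_elem :: 'a poly \<Rightarrow> bool) \<and>
    factorizations_agree (irreducible_elem :: 'a poly \<Rightarrow> bool) homomorphic"
  have UFD: ?UFD if irr: "irr \<in> irreducibility_kinds" and atomic: "atomic_wrt irr"
    and hom: "factorizations_agree irr homomorphic" for irr :: "'a poly \<Rightarrow> bool"
  proof -
    have dom: "zero_divisor_free TYPE('a poly)"
      using coefficients_zero_divisor_free[OF that] by (simp add: zero_divisor_free_poly_iff)
    then show ?thesis
      using homomorphic_factorizations_imp_UFD[OF dom that] unique_factorization_domain_iff by blast
  qed
  have UFD_UFR: "?UFR \<and> ?hom" if ?UFD
  proof -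
    have atomic: "atomic_wrt (irreducible_elem :: 'a poly \<Rightarrow> bool)"
      and iso: "factorizations_agree (irreducible_elem :: 'a poly \<Rightarrow> bool) (isomorphic_wrt associates)"
      using UFD_imp_irreducible_factorization that unfolding unique_factorization_domain_iff by blast+
    have ?UFR
      unfolding unique_factorization_ring_def using atomic iso by blast
    moreover have ?hom
      using atomic iso isomorphic_wrt_imp_homomorphic[of associates]
      unfolding factorizations_agree_def by blast
    ultimately show ?thesis ..
  qed
  have UFR_UFD: ?UFD if UFR: ?UFR
  proof -
    obtain irr :: "'a poly \<Rightarrow> bool" and rel where irr: "irr \<in> irreducibility_kinds" "atomic_wrt irr"
      and rel: "rel \<in> {associates, strong_associates, very_strong_associates}"
      and iso: "factorizations_agree irr (isomorphic_wrt rel)"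
      using UFR unfolding unique_factorization_ring_def irreducibility_kinds_def[symmetric]
      by (elim bexE conjE)
    have "factorizations_agree irr homomorphic"
      using iso isomorphic_wrt_imp_homomorphic[OF rel] unfolding factorizations_agree_def by meson
    then show ?thesis
      by (rule UFD[OF irr])
  qed
  have hom_UFD: ?UFD if ?hom
    using that UFD[OF irreducible_elem_kind] by blast
  show ?thesis
    using unique_factorization_domain_poly_iff UFD_UFR UFR_UFD hom_UFD by blast
qed

end
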